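(* Let $d,t\in\mathbb{N}$ and let $\mathcal{Y}_M=\{y_1,\dots,y_M\}\subset\mathbb{S}^d$ be a set of $M$ points on the sphere. Then for all sufficiently large $N$ there exists a point set $\mathcal{X}_N=\{x_1,\dots,x_N\}\subset\mathbb{S}^d$ such that the union $\mathcal{X}_N\cup\mathcal{Y}_M$ is a spherical $t$-design.
   Context: $\mathbb{S}^d=\{x\in\mathbb{R}^{d+1}:|x|=1\}$, and $\mu_d$ is the normalized Lebesgue (surface) measure with $\mu_d(\mathbb{S}^d)=1$. All point sets are finite multisets (points may coincide), and unions are multiset unions, so $\mathcal{X}_N\cup\mathcal{Y}_M$ has $N+M$ points counted with multiplicity. A multiset $\{z_1,\dots,z_K\}\subset\mathbb{S}^d$ is a spherical $t$-design if $\int_{\mathbb{S}^d}P(x)\,d\mu_d(x)=\frac1K\sum_{i=1}^K P(z_i)$ for all real polynomials $P$ in $d+1$ variables of degree at most $t$. *)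

theory Defs
  imports "HOL-Probability.Probability"
begin

section \<open>Normalized surface measure on the unit sphere\<close>

text \<open>
  The surface measure of a Borel set \<open>A\<close> of the unit sphere of \<open>\<real>\<^sup>n\<close> is \<open>n\<close> times the
  Lebesgue measure of the cone \<open>{r a | a \<in> A, 0 < r \<le> 1}\<close>.  The normalization divides by the
  total surface area, which is \<open>n\<close> times the volume of the unit ball, so the factor \<open>n\<close>
  cancels.  The origin is removed because \<open>sgn 0 = 0\<close> is not on the sphere.
\<close>

definition sphere_measure :: "'a::euclidean_space measure" where
  "sphere_measure =
     scale_measure (1 / emeasure lborel (cball (0::'a) 1))
       (distr (restrict_space lborel (cball 0 1 - {0})) (restrict_space borel (sphere 0 1)) sgn)"

lemma sgn_measurable_sphere:
  "sgn \<in> measurable (restrict_space lborel (cball (0::'a::euclidean_space) 1 - {0}))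
                      (restrict_space borel (sphere 0 1))"
  by (intro measurable_restrict_space2 measurable_restrict_space1)
     (auto simp: space_restrict_space norm_sgn)

lemma space_sphere_measure [simp]: "space sphere_measure = sphere (0::'a::euclidean_space) 1"
  by (simp add: sphere_measure_def space_scale_measure space_restrict_space)

lemma sets_sphere_measure:
  "sets sphere_measure = sets (restrict_space borel (sphere (0::'a::euclidean_space) 1))"
  by (simp add: sphere_measure_def)

lemma emeasure_sphere_measure:
  fixes A :: "'a::euclidean_space set"
  assumes "A \<in> sets borel" "A \<subseteq> sphere 0 1"
  shows "emeasure sphere_measure A =
           emeasure lborel {x \<in> cball 0 1 - {0}. sgn x \<in> A} / emeasure lborel (cball (0::'a) 1)"
proof -
  have A: "A \<in> sets (restrict_space borel (sphere (0::'a) 1))"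
    using assms by (auto simp: sets_restrict_space_iff)
  have eq: "sgn -` A \<inter> (cball 0 1 - {0}) = {x \<in> cball 0 1 - {0}. sgn x \<in> A}" by auto
  have "emeasure (distr (restrict_space lborel (cball 0 1 - {0}))
          (restrict_space borel (sphere 0 1)) sgn) A
        = emeasure lborel {x \<in> cball 0 1 - {0}. sgn x \<in> A}"
    by (subst emeasure_distr[OF sgn_measurable_sphere A], subst emeasure_restrict_space)
       (auto simp: space_restrict_space eq)
  then show ?thesis
    by (simp add: sphere_measure_def divide_ennreal_def mult.commute)
qed

lemma prob_space_sphere_measure: "prob_space (sphere_measure :: 'a::euclidean_space measure)"
proof
  have 1: "{x \<in> cball 0 1 - {0}. sgn x \<in> sphere 0 1} = cball (0::'a) 1 - {0}"
    by (auto simp: norm_sgn)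
  have 2: "emeasure lborel (cball (0::'a) 1 - {0}) = emeasure lborel (cball (0::'a) 1)"
    by (subst emeasure_Diff) auto
  have "emeasure lborel (cball (0::'a) 1) \<noteq> 0"
    by (simp add: emeasure_cball unit_ball_vol_def ennreal_eq_0_iff not_le)
  moreover have "emeasure lborel (cball (0::'a) 1) < \<top>"
    by (simp add: emeasure_cball)
  ultimately show "emeasure (sphere_measure :: 'a measure) (space sphere_measure) = 1"
    by (simp only: space_sphere_measure, subst emeasure_sphere_measure)
       (simp_all only: 1 2 ennreal_divide_self, auto)
qed

text \<open>The sort \<open>wellorder\<close> is inherited from \<open>measure_orthogonal_image\<close>.\<close>

lemma sphere_measure_orthogonal_invariant:
  fixes f :: "real^'n::{finite,wellorder} \<Rightarrow> real^'n::_"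
  assumes f: "orthogonal_transformation f" and A: "A \<in> sets borel" "A \<subseteq> sphere 0 1"
  shows "emeasure sphere_measure (f ` A) = emeasure sphere_measure A"
proof -
  have n: "\<And>x. norm (f x) = norm x" and b: "bij f"
    using f by (simp_all add: orthogonal_transformation_norm orthogonal_transformation_bij)
  define g where "g = inv f"
  have g: "orthogonal_transformation g" "\<And>x. f (g x) = x" "\<And>x. g (f x) = x"
    using orthogonal_transformation_inv[OF f] b
    by (simp_all add: g_def bij_is_inj bij_is_surj surj_f_inv_f)
  have gn: "\<And>x. norm (g x) = norm x" using g(1) by (simp add: orthogonal_transformation_norm)
  have im: "f ` T = g -` T" for T using g(3) by (auto simp: image_iff) (metis g(2))
  have gm: "g \<in> borel_measurable borel"
    using orthogonal_transformation_linear[OF g(1)]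
    by (intro borel_measurable_continuous_onI linear_continuous_on) (simp add: linear_linear)
  have fA: "f ` A \<in> sets borel"
    using measurable_sets[OF gm A(1)] by (simp add: im)
  have fA': "f ` A \<subseteq> sphere 0 1"
    using subsetD[OF A(2)] by (simp add: image_subset_iff n)
  let ?C = "\<lambda>A. {x \<in> cball 0 1 - {0}. sgn x \<in> A}"
  have sg: "sgn (g x) = g (sgn x)" for x
    using g(1) by (simp add: sgn_div_norm gn orthogonal_transformation_linear linear_cmul)
  have C: "?C (f ` A) = f ` ?C A"
  proof -
    have "g x = 0 \<longleftrightarrow> x = 0" for x
      using gn[of x] norm_eq_zero[of x] norm_eq_zero[of "g x"] by argo
    then show ?thesis by (auto simp: im sg gn)
  qed
  have m: "?C B \<in> sets borel" if "B \<in> sets borel" for B :: "(real^'n::_) set"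
    using that by measurable
  have fin: "?C B \<in> lmeasurable" if "B \<in> sets borel" for B :: "(real^'n::_) set"
    by (rule bounded_set_imp_lmeasurable)
       (use m[OF that] bounded_subset[OF bounded_cball[of 0 1], of "?C B"]
         in \<open>simp_all only: sets_completionI_sets sets_lborel Collect_restrict Diff_subset subset_trans[OF Collect_restrict]\<close>)
  have key: "emeasure lborel (?C B) = ennreal (measure lebesgue (?C B))" if "B \<in> sets borel"
    for B :: "(real^'n::_) set"
  proof -
    have "emeasure lebesgue (?C B) = emeasure lborel (?C B)"
      using m[OF that] by (simp del: mem_Collect_eq)
    then show ?thesis using emeasure_eq_measure2[OF fin[OF that]] by simp
  qed
  have "emeasure lborel (?C (f ` A)) = emeasure lborel (?C A)"
    by (simp only: key[OF fA] key[OF A(1)]) (simp only: C measure_orthogonal_image[OF f fin[OF A(1)]])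
  then show ?thesis
    by (simp only: emeasure_sphere_measure[OF A] emeasure_sphere_measure[OF fA fA'])
qed

section \<open>Polynomials of bounded degree\<close>

text \<open>A multi-index is a function \<open>\<alpha> :: 'n \<Rightarrow> nat\<close>; the sum ranges over a finite set by
  \<open>finite_multi_indices\<close> below.\<close>

definition polynomial_degree_le :: "nat \<Rightarrow> (real^'n \<Rightarrow> real) \<Rightarrow> bool" where
  "polynomial_degree_le t P \<longleftrightarrow>
     (\<exists>c :: ('n \<Rightarrow> nat) \<Rightarrow> real.
        P = (\<lambda>x. \<Sum>\<alpha> | (\<Sum>i\<in>UNIV. \<alpha> i) \<le> t. c \<alpha> * (\<Prod>i\<in>UNIV. (x $ i) ^ \<alpha> i)))"

lemma finite_multi_indices: "finite {\<alpha> :: 'n::finite \<Rightarrow> nat. (\<Sum>i\<in>UNIV. \<alpha> i) \<le> t}"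
proof -
  have "\<alpha> i \<le> t" if "sum \<alpha> UNIV \<le> t" for \<alpha> :: "'n \<Rightarrow> nat" and i
    using member_le_sum[of i UNIV \<alpha>] that by simp
  then have "{\<alpha> :: 'n \<Rightarrow> nat. sum \<alpha> UNIV \<le> t} \<subseteq> UNIV \<rightarrow>\<^sub>E {..t}"
    by auto
  then show ?thesis
    by (rule finite_subset) (simp add: finite_PiE)
qed

section \<open>Spherical designs\<close>

definition spherical_design :: "nat \<Rightarrow> (real^'n) multiset \<Rightarrow> bool" where
  "spherical_design t Z \<longleftrightarrow>
     set_mset Z \<subseteq> sphere 0 1 \<and>
     (\<forall>P. polynomial_degree_le t P \<longrightarrow>
        (LINT x|sphere_measure. P x) = (1 / real (size Z)) * (\<Sum>z\<in>#Z. P z))"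

lemma integrable_polynomial_sphere_measure:
  fixes P :: "real^'n \<Rightarrow> real"
  assumes "polynomial_degree_le t P"
  shows "integrable sphere_measure P"
proof -
  interpret prob_space "sphere_measure :: (real^'n) measure" by (rule prob_space_sphere_measure)
  have c: "continuous_on UNIV P"
    using assms unfolding polynomial_degree_le_def
    by (elim exE, hypsubst) (intro continuous_intros)
  have "compact (P ` sphere 0 1)"
    by (rule compact_continuous_image[OF continuous_on_subset[OF c] compact_sphere]) simp
  then obtain B where B: "\<And>x. x \<in> sphere 0 1 \<Longrightarrow> \<bar>P x\<bar> \<le> B"
    by (fastforce dest!: compact_imp_bounded simp: bounded_iff)
  have "P \<in> borel_measurable sphere_measure"
    using borel_measurable_continuous_onI[OF c]
    by (subst measurable_cong_sets[OF sets_sphere_measure refl]) (rule measurable_restrict_space1)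
  then show ?thesis
    by (intro integrable_const_bound[of _ B] AE_I2) (simp_all add: B)
qed

end

theory Submission
  imports Defs
begin

text \<open>
  Subtracting the mean from each monomial turns the design property into the requirement that
  finitely many mean-zero functions on the sphere sum to zero over the point set.  Write \<open>f(z)\<close> for the
  vector of their values at \<open>z\<close>.  The sum of \<open>f\<close> over \<open>Y\<close> is a fixed vector, and for every large \<open>N\<close>
  a choice of \<open>N\<close> points is needed whose values of \<open>f\<close> add up to the opposite vector.
  Two observations achieve this.

  Bounded error (\<open>greedy_bounded_sums\<close>, \<open>descent_direction\<close>).  Every nontrivial linear combination
  of independent mean-zero functions is negative somewhere, by an amount comparable with its
  coefficient vector.  So, whatever the current sum \<open>v\<close> of vectors is, there is a point \<open>z\<close> with
  \<open>v \<bullet> f(z) \<le> - c |v|\<close>.  Adding such points greedily brings the sum into a ball of a fixed radius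
  and keeps it there, from any starting vector and for any sufficiently large number of points.

  Local freedom (\<open>near_identity_covers_cube\<close>, \<open>tangent_dual_system\<close>).  The sphere is connected by great circles, so a
  mean-zero function whose derivatives along all great circles vanish is zero.  Hence
  there are finitely many points such that moving each of them along a great circle changes the sum of
  \<open>f\<close> in linearly independent directions, and the sums over the moved points fill a
  neighbourhood of the sum over the original points.  With \<open>k\<close> copies of this block the
  neighbourhood is \<open>k\<close> times as large.

  Now \<open>k\<close> is taken so large that the freedom of the blocks exceeds the radius of the greedy ball,
  the greedy choice is started at the sum over \<open>Y\<close> and the \<open>k\<close> blocks, and the remaining
  error is removed by moving the blocks (\<open>exists_completion_with_zero_sums\<close>).
\<close>

section \<open>Sums of near-identity functions cover a cube\<close>

lemma C1_imp_DERIV: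
  fixes f :: "real \<Rightarrow> real"
  assumes "f C1_differentiable_on UNIV"
  shows "(f has_real_derivative deriv f a) (at a)"
  using assms unfolding DERIV_deriv_iff_real_differentiable C1_differentiable_on_eq by blast

lemma C1_strict_derivative:
  fixes f :: "real \<Rightarrow> real"
  assumes C1: "f C1_differentiable_on UNIV" and der: "(f has_real_derivative c) (at a)" and "0 < \<epsilon>"
  obtains \<delta> where "0 < \<delta>"
    "\<And>x y. \<lbrakk>\<bar>x - a\<bar> \<le> \<delta>; \<bar>y - a\<bar> \<le> \<delta>\<rbrakk> \<Longrightarrow> \<bar>f x - f y - c * (x - y)\<bar> \<le> \<epsilon> * \<bar>x - y\<bar>"
proof -
  obtain f' where f': "\<And>x. (f has_real_derivative f' x) (at x)" and cont: "continuous_on UNIV f'"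
    using C1 unfolding C1_differentiable_on_def has_real_derivative_iff_has_vector_derivative by auto
  have c: "f' a = c"
    using f' der DERIV_unique by blast
  obtain \<delta> where "0 < \<delta>" and \<delta>: "\<And>x. dist x a < \<delta> \<Longrightarrow> dist (f' x) (f' a) < \<epsilon>"
    using cont \<open>0 < \<epsilon>\<close> unfolding continuous_on_iff by (metis UNIV_I)
  show ?thesis
  proof
    show "0 < \<delta> / 2" using \<open>0 < \<delta>\<close> by simp
    fix x y assume xy: "\<bar>x - a\<bar> \<le> \<delta> / 2" "\<bar>y - a\<bar> \<le> \<delta> / 2"
    have "norm ((f x - c * x) - (f y - c * y)) \<le> \<epsilon> * norm (x - y)"
    proof (rule field_differentiable_bound)
      show "convex (cball a (\<delta> / 2))" by simp
      show "((\<lambda>x. f x - c * x) has_field_derivative f' z - c) (at z within cball a (\<delta> / 2))" for z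
        by (auto intro!: derivative_eq_intros has_field_derivative_at_within[OF f'])
      show "norm (f' z - c) \<le> \<epsilon>" if "z \<in> cball a (\<delta> / 2)" for z
        using \<delta>[of z] that \<open>0 < \<delta>\<close> c by (simp add: dist_real_def abs_minus_commute)
    qed (use xy in \<open>auto simp: dist_real_def abs_minus_commute\<close>)
    then show "\<bar>f x - f y - c * (x - y)\<bar> \<le> \<epsilon> * \<bar>x - y\<bar>"
      by (simp add: algebra_simps)
  qed
qed

text \<open>
  The map \<open>s \<mapsto> (\<Sum>\<^sub>j \<phi>\<^sub>i\<^sub>j(s\<^sub>j))\<^sub>i\<close> has the identity matrix as its derivative at the origin, so it is an
  open map there.  The number of coordinates \<open>m\<close> is a natural number and not a type, so the point
  with a prescribed value is constructed by the simplified Newton iteration, whose step halves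
  the increments in the maximum norm.
\<close>

lemma near_identity_covers_cube:
  fixes \<phi> :: "nat \<Rightarrow> nat \<Rightarrow> real \<Rightarrow> real"
  assumes C1: "\<And>i j. \<lbrakk>i < m; j < m\<rbrakk> \<Longrightarrow> \<phi> i j C1_differentiable_on UNIV"
    and der: "\<And>i j. \<lbrakk>i < m; j < m\<rbrakk> \<Longrightarrow> (\<phi> i j has_real_derivative of_bool (i = j)) (at 0)"
  obtains r where "0 < r"
    "\<And>u. (\<And>i. i < m \<Longrightarrow> \<bar>u i\<bar> \<le> r) \<Longrightarrow>
       \<exists>s. \<forall>i<m. (\<Sum>j<m. \<phi> i j (s j)) = (\<Sum>j<m. \<phi> i j 0) + u i"
proof -
  \<comment> \<open>Each of the \<open>m\<close> summands may deviate from linearity by \<open>\<epsilon>\<close>; together they deviate by at most \<open>1/2\<close>.\<close>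
  define \<epsilon> where "\<epsilon> = 1 / (2 * (real m + 1))"
  have \<epsilon>: "0 < \<epsilon>" "real m * \<epsilon> \<le> 1 / 2"
    by (auto simp: \<epsilon>_def field_simps)
  have "\<exists>\<delta>>0. \<forall>x y. \<bar>x\<bar> \<le> \<delta> \<longrightarrow> \<bar>y\<bar> \<le> \<delta> \<longrightarrow>
          \<bar>\<phi> i j x - \<phi> i j y - of_bool (i = j) * (x - y)\<bar> \<le> \<epsilon> * \<bar>x - y\<bar>" if "i < m" "j < m" for i j
    using C1_strict_derivative[OF C1[OF that] der[OF that] \<epsilon>(1)] by (metis diff_zero)
  then obtain \<Delta> where \<Delta>0: "\<And>i j. \<lbrakk>i < m; j < m\<rbrakk> \<Longrightarrow> 0 < \<Delta> i j"
    and \<Delta>: "\<And>i j x y. \<lbrakk>i < m; j < m; \<bar>x\<bar> \<le> \<Delta> i j; \<bar>y\<bar> \<le> \<Delta> i j\<rbrakk> \<Longrightarrow>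
          \<bar>\<phi> i j x - \<phi> i j y - of_bool (i = j) * (x - y)\<bar> \<le> \<epsilon> * \<bar>x - y\<bar>"
    by metis
  define \<delta> where "\<delta> = Min (insert 1 ((\<lambda>(i, j). \<Delta> i j) ` ({..<m} \<times> {..<m})))"
  have "0 < \<delta>"
    using \<Delta>0 by (auto simp: \<delta>_def)
  have \<delta>_le: "\<delta> \<le> \<Delta> i j" if "i < m" "j < m" for i j
    unfolding \<delta>_def using that by (intro Min_le) auto
  have est: "\<bar>x i - y i - ((\<Sum>j<m. \<phi> i j (x j)) - (\<Sum>j<m. \<phi> i j (y j)))\<bar> \<le> b / 2"
    if "i < m" and x: "\<And>j. j < m \<Longrightarrow> \<bar>x j\<bar> \<le> \<delta>" and y: "\<And>j. j < m \<Longrightarrow> \<bar>y j\<bar> \<le> \<delta>"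
      and b: "\<And>j. j < m \<Longrightarrow> \<bar>x j - y j\<bar> \<le> b" for x y :: "nat \<Rightarrow> real" and i b
  proof -
    have "0 \<le> b" using b[OF \<open>i < m\<close>] by simp
    have "x i - y i = (\<Sum>j<m. of_bool (i = j) * (x j - y j))"
      using \<open>i < m\<close> by simp
    then have "\<bar>x i - y i - ((\<Sum>j<m. \<phi> i j (x j)) - (\<Sum>j<m. \<phi> i j (y j)))\<bar>
        = \<bar>\<Sum>j<m. \<phi> i j (x j) - \<phi> i j (y j) - of_bool (i = j) * (x j - y j)\<bar>"
      by (simp only: sum_subtractf abs_minus_commute)
    also have "\<dots> \<le> (\<Sum>j<m. \<bar>\<phi> i j (x j) - \<phi> i j (y j) - of_bool (i = j) * (x j - y j)\<bar>)"
      by (rule sum_abs)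
    also have "\<dots> \<le> (\<Sum>j<m. \<epsilon> * b)"
    proof (rule sum_mono)
      fix j assume "j \<in> {..<m}"
      then have j: "j < m" by simp
      have "\<bar>\<phi> i j (x j) - \<phi> i j (y j) - of_bool (i = j) * (x j - y j)\<bar> \<le> \<epsilon> * \<bar>x j - y j\<bar>"
        using x[OF j] y[OF j] \<delta>_le[OF \<open>i < m\<close> j] by (intro \<Delta>[OF \<open>i < m\<close> j]) auto
      also have "\<dots> \<le> \<epsilon> * b"
        using b[OF j] \<epsilon>(1) by simp
      finally show "\<bar>\<phi> i j (x j) - \<phi> i j (y j) - of_bool (i = j) * (x j - y j)\<bar> \<le> \<epsilon> * b" .
    qed
    also have "\<dots> = (real m * \<epsilon>) * b" by simp
    also have "\<dots> \<le> 1 / 2 * b"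
      using \<epsilon>(2) \<open>0 \<le> b\<close> by (rule mult_right_mono)
    finally show ?thesis by simp
  qed
  show ?thesis
  proof
    show "0 < \<delta> / 2" using \<open>0 < \<delta>\<close> by simp
    fix u :: "nat \<Rightarrow> real" assume u: "\<And>i. i < m \<Longrightarrow> \<bar>u i\<bar> \<le> \<delta> / 2"
    \<comment> \<open>A fixed point of \<open>T\<close> is a solution, and \<open>T\<close> is a contraction on the cube of half-width \<open>\<delta>\<close>.\<close>
    define T where "T s i = s i - ((\<Sum>j<m. \<phi> i j (s j)) - (\<Sum>j<m. \<phi> i j 0)) + u i" for s i
    define w where "w n = (T ^^ n) (\<lambda>_. 0)" for n
    have w0: "w 0 i = 0" and wS: "w (Suc n) = T (w n)" for n i
      by (simp_all add: w_def)
    have T_diff: "T x i - T y i = x i - y i - ((\<Sum>j<m. \<phi> i j (x j)) - (\<Sum>j<m. \<phi> i j (y j)))" for x y i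
      by (simp add: T_def)
    have w_bounds: "(\<forall>i<m. \<bar>w (Suc n) i - w n i\<bar> \<le> \<delta> / 2 * (1/2) ^ n) \<and>
        (\<forall>i<m. \<bar>w n i\<bar> \<le> \<delta> * (1 - (1/2) ^ n)) \<and> (\<forall>i<m. \<bar>w (Suc n) i\<bar> \<le> \<delta> * (1 - (1/2) ^ Suc n))" for n
    proof (induction n)
      case 0
      then show ?case using u by (simp add: wS w0 T_def)
    next
      case (Suc n)
      have le: "\<delta> * (1 - (1/2) ^ k) \<le> \<delta>" for k :: nat
        using \<open>0 < \<delta>\<close> by (simp add: algebra_simps)
      have step: "\<bar>w (Suc (Suc n)) i - w (Suc n) i\<bar> \<le> \<delta> / 2 * (1/2) ^ Suc n" if "i < m" for i
      proof -
        have "\<bar>T (w (Suc n)) i - T (w n) i\<bar> \<le> (\<delta> / 2 * (1/2) ^ n) / 2"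
          unfolding T_diff using Suc.IH le by (intro est that) (blast intro: order_trans)+
        then show ?thesis by (simp add: wS)
      qed
      moreover have "\<bar>w (Suc (Suc n)) i\<bar> \<le> \<delta> * (1 - (1/2) ^ Suc (Suc n))" if "i < m" for i
      proof -
        have "\<bar>w (Suc n) i\<bar> \<le> \<delta> * (1 - (1/2) ^ Suc n)" using Suc.IH that by blast
        with step[OF that] show ?thesis by (simp add: algebra_simps abs_if split: if_splits)
      qed
      ultimately show ?case using Suc.IH by blast
    qed
    have "convergent (\<lambda>n. w n i)" if "i < m" for i
    proof -
      have "summable (\<lambda>n. w (Suc n) i - w n i)"
      proof (rule summable_comparison_test')
        show "summable (\<lambda>n. \<delta> / 2 * (1/2::real) ^ n)"
          by (intro summable_mult summable_geometric) simp
        show "norm (w (Suc n) i - w n i) \<le> \<delta> / 2 * (1/2) ^ n" if "0 \<le> n" for n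
          using w_bounds[of n] \<open>i < m\<close> by simp
      qed
      then have "(\<lambda>n. \<Sum>k<n. w (Suc k) i - w k i) \<longlonglongrightarrow> (\<Sum>k. w (Suc k) i - w k i)"
        by (rule summable_LIMSEQ)
      then show ?thesis
        unfolding sum_lessThan_telescope[of "\<lambda>n. w n i"] w0 by (auto simp: convergent_def)
    qed
    then obtain s where s: "\<And>i. i < m \<Longrightarrow> (\<lambda>n. w n i) \<longlonglongrightarrow> s i"
      unfolding convergent_def by metis
    have "(\<Sum>j<m. \<phi> i j (s j)) = (\<Sum>j<m. \<phi> i j 0) + u i" if "i < m" for i
    proof -
      have "(\<lambda>n. \<phi> i j (w n j)) \<longlonglongrightarrow> \<phi> i j (s j)" if "j < m" for j
      proof (rule isCont_tendsto_compose[OF _ s[OF that]])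
        have "continuous_on UNIV (\<phi> i j)"
          using C1_diff_imp_diff[OF C1[OF \<open>i < m\<close> that]] differentiable_imp_continuous_on by blast
        then show "isCont (\<phi> i j) (s j)" by (simp add: continuous_on_eq_continuous_at)
      qed
      then have "(\<lambda>n. T (w n) i) \<longlonglongrightarrow> T s i"
        unfolding T_def using s[OF that] by (intro tendsto_intros) auto
      moreover have "(\<lambda>n. T (w n) i) \<longlonglongrightarrow> s i"
        using LIMSEQ_Suc[OF s[OF that]] by (simp add: wS)
      ultimately have "T s i = s i" by (rule LIMSEQ_unique)
      then show ?thesis by (simp add: T_def)
    qed
    then show "\<exists>s. \<forall>i<m. (\<Sum>j<m. \<phi> i j (s j)) = (\<Sum>j<m. \<phi> i j 0) + u i" by blast
  qed
qed

section \<open>Dual systems of functions and functionals\<close>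

text \<open>
  A finite-dimensional space of functions has a basis that is dual to functionals taken from any
  given separating family.  This is the device that selects finitely many derivatives at points
  of the sphere, and later finitely many test functions, without any reference to dimension:
  the generators are processed one at a time.  After subtraction of its projection to the
  span of the current system, a generator is annihilated by all current functionals; either
  it vanishes on \<open>S\<close>, or some functional detects it and extends the system.  Functions matter
  only on \<open>S\<close>, which is why the expansions are asserted there only.
\<close>

lemma dual_system:
  fixes V :: "('a \<Rightarrow> real) set" and \<Lambda> :: "(('a \<Rightarrow> real) \<Rightarrow> real) set"
  assumes V: "\<And>f g c. \<lbrakk>f \<in> V; g \<in> V\<rbrakk> \<Longrightarrow> (\<lambda>x. f x + c * g x) \<in> V"
    and lin: "\<And>D f g c. \<lbrakk>D \<in> \<Lambda>; f \<in> V; g \<in> V\<rbrakk> \<Longrightarrow> D (\<lambda>x. f x + c * g x) = D f + c * D g"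
    and sep: "\<And>f. \<lbrakk>f \<in> V; \<And>D. D \<in> \<Lambda> \<Longrightarrow> D f = 0\<rbrakk> \<Longrightarrow> \<forall>x\<in>S. f x = 0"
    and F: "finite F" "F \<subseteq> V"
  obtains m :: nat and P D where "\<And>i. i < m \<Longrightarrow> P i \<in> V" "\<And>j. j < m \<Longrightarrow> D j \<in> \<Lambda>"
    "\<And>i j. \<lbrakk>i < m; j < m\<rbrakk> \<Longrightarrow> D j (P i) = of_bool (i = j)"
    "\<And>f. f \<in> F \<Longrightarrow> \<exists>c. \<forall>x\<in>S. f x = (\<Sum>i<m. c i * P i x)"
proof -
  have comb: "(\<lambda>x. f x + (\<Sum>i<n. c i * P i x)) \<in> V \<and>
      (\<forall>D\<in>\<Lambda>. D (\<lambda>x. f x + (\<Sum>i<n. c i * P i x)) = D f + (\<Sum>i<n. c i * D (P i)))"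
    if "f \<in> V" "\<And>i. i < n \<Longrightarrow> P i \<in> V" for f c P and n :: nat
    using that(2)
  proof (induction n)
    case 0
    then show ?case using that(1) by simp
  next
    case (Suc n)
    let ?g = "\<lambda>x. f x + (\<Sum>i<n. c i * P i x)"
    have IH: "?g \<in> V" "\<And>D. D \<in> \<Lambda> \<Longrightarrow> D ?g = D f + (\<Sum>i<n. c i * D (P i))" and "P n \<in> V"
      using Suc by auto
    have eq: "(\<lambda>x. f x + (\<Sum>i<Suc n. c i * P i x)) = (\<lambda>x. ?g x + c n * P n x)"
      by (simp add: add.assoc)
    show ?case
      unfolding eq using V[OF IH(1) \<open>P n \<in> V\<close>] by (auto simp: lin[OF _ IH(1) \<open>P n \<in> V\<close>] IH(2))
  qed
  have "\<exists>(m::nat) P D. (\<forall>i<m. P i \<in> V \<and> D i \<in> \<Lambda>) \<and> (\<forall>i<m. \<forall>j<m. D j (P i) = of_bool (i = j)) \<and>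
      (\<forall>f\<in>F. \<exists>c. \<forall>x\<in>S. f x = (\<Sum>i<m. c i * P i x))"
    using F
  proof (induction F)
    case empty
    show ?case by (rule exI[of _ 0]) simp
  next
    case (insert f F)
    then have "\<exists>(m::nat) P D. (\<forall>i<m. P i \<in> V \<and> D i \<in> \<Lambda>) \<and> (\<forall>i<m. \<forall>j<m. D j (P i) = of_bool (i = j)) \<and>
      (\<forall>f\<in>F. \<exists>c. \<forall>x\<in>S. f x = (\<Sum>i<m. c i * P i x))" by simp
    then obtain m :: nat and P D where *: "\<forall>i<m. P i \<in> V \<and> D i \<in> \<Lambda>"
        "\<forall>i<m. \<forall>j<m. D j (P i) = of_bool (i = j)"
        "\<forall>f\<in>F. \<exists>c. \<forall>x\<in>S. f x = (\<Sum>i<m. c i * P i x)" by (elim exE conjE)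
    have PD: "\<And>i. i < m \<Longrightarrow> P i \<in> V" "\<And>i. i < m \<Longrightarrow> D i \<in> \<Lambda>"
      and dual: "\<And>i j. \<lbrakk>i < m; j < m\<rbrakk> \<Longrightarrow> D j (P i) = of_bool (i = j)"
      and span: "\<And>f. f \<in> F \<Longrightarrow> \<exists>c. \<forall>x\<in>S. f x = (\<Sum>i<m. c i * P i x)"
      using * by auto
    have "f \<in> V" "F \<subseteq> V" using insert.prems by auto
    define R where "R x = f x + (\<Sum>i<m. (- D i f) * P i x)" for x
    have RV: "R \<in> V"
      using comb[OF \<open>f \<in> V\<close>, of m P "\<lambda>i. - D i f"] PD(1) by (simp add: R_def[abs_def])
    have DR: "E R = E f - (\<Sum>i<m. D i f * E (P i))" if "E \<in> \<Lambda>" for E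
      using comb[OF \<open>f \<in> V\<close>, of m P "\<lambda>i. - D i f"] PD(1) that
      by (simp add: R_def[abs_def] sum_negf)
    have DjR: "D j R = 0" if "j < m" for j
      using DR[OF PD(2)[OF that]] that dual by (simp add: sum.delta')
    show ?case
    proof (cases "\<forall>E\<in>\<Lambda>. E R = 0")
      case True
      then have "\<forall>x\<in>S. R x = 0" using sep[OF RV] by blast
      then have "\<forall>x\<in>S. f x = (\<Sum>i<m. D i f * P i x)"
        by (simp add: R_def sum_negf)
      with PD dual span show ?thesis by (intro exI[of _ m] exI[of _ P] exI[of _ D]) auto
    next
      case False
      then obtain E where E: "E \<in> \<Lambda>" "E R \<noteq> 0" by blast
      \<comment> \<open>The quotient \<open>R / E R\<close>, in the one form of linear combination under which \<open>V\<close> is closed.\<close>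
      define Q where "Q x = R x + (1 / E R - 1) * R x" for x
      have Q: "Q x = R x / E R" for x
        using E by (simp add: Q_def field_simps)
      have QV: "Q \<in> V" unfolding Q_def[abs_def] by (intro V RV)
      have DQ: "D' Q = D' R / E R" if "D' \<in> \<Lambda>" for D'
        unfolding Q_def[abs_def] by (subst lin[OF that RV RV]) (use E in \<open>simp add: field_simps\<close>)
      define P' where "P' i = (if i < m then (\<lambda>x. P i x + (- E (P i)) * Q x) else Q)" for i
      define D' where "D' i = (if i < m then D i else E)" for i
      have P'V: "P' i \<in> V" if "i < Suc m" for i
        unfolding P'_def by (cases "i < m") (simp_all only: V[OF PD(1) QV] QV if_True if_False)
      have D'\<Lambda>: "D' i \<in> \<Lambda>" if "i < Suc m" for i
        using that PD(2) E by (auto simp: D'_def)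
      have lin': "D'' (\<lambda>x. P i x - E (P i) * Q x) = D'' (P i) - E (P i) * D'' Q" if "D'' \<in> \<Lambda>" "i < m" for D'' i
        using lin[OF that(1) PD(1)[OF that(2)] QV, of "- E (P i)"] by simp
      have dual': "D' j (P' i) = of_bool (i = j)" if "i < Suc m" "j < Suc m" for i j
        using that dual E PD(2) DjR
        by (auto simp: D'_def P'_def lin' DQ less_Suc_eq)
      have span': "\<exists>c. \<forall>x\<in>S. g x = (\<Sum>i<Suc m. c i * P' i x)"
        if g: "\<And>x. x \<in> S \<Longrightarrow> g x = (\<Sum>i<m. c i * P i x) + a * Q x" for g c a
      proof -
        define c' where "c' i = (if i < m then c i else a + (\<Sum>i<m. c i * E (P i)))" for i
        have "(\<Sum>i<Suc m. c' i * P' i x) = (\<Sum>i<m. c i * P i x) + a * Q x" for x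
          by (simp add: c'_def P'_def algebra_simps sum_subtractf sum_distrib_left)
        with g show ?thesis by (intro exI[of _ c']) simp
      qed
      have "\<exists>c. \<forall>x\<in>S. g x = (\<Sum>i<Suc m. c i * P' i x)" if "g \<in> insert f F" for g
      proof (cases "g = f")
        case True
        show ?thesis
          by (rule span'[of _ "\<lambda>i. D i f" "E R"]) (use E True in \<open>simp add: Q R_def sum_negf\<close>)
      next
        case False
        then obtain c where "\<forall>x\<in>S. g x = (\<Sum>i<m. c i * P i x)" using span \<open>g \<in> insert f F\<close> by blast
        then show ?thesis by (intro span'[of _ c 0]) simp
      qed
      with P'V D'\<Lambda> dual' show ?thesis
        by (intro exI[of _ "Suc m"] exI[of _ P'] exI[of _ D']) blast
    qed
  qed
  then obtain m :: nat and P D where "\<forall>i<m. P i \<in> V \<and> D i \<in> \<Lambda>"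
      "\<forall>i<m. \<forall>j<m. D j (P i) = of_bool (i = j)"
      "\<forall>f\<in>F. \<exists>c. \<forall>x\<in>S. f x = (\<Sum>i<m. c i * P i x)" by (elim exE conjE)
  then show ?thesis by (intro that[of m P D]) blast+
qed

section \<open>Greedy choice keeps vector sums bounded\<close>

text \<open>
  If every vector \<open>v\<close> admits a point whose value vector has inner product at most
  \<open>- c |v|\<close> with it, then adding such a point to a sum \<open>v\<close> changes \<open>|v|\<^sup>2\<close> by at most
  \<open>- 2 c |v| + C\<close>.  Outside a ball of fixed radius the energy therefore drops by at least one
  at each step, and a sum that has entered a certain ball never leaves it.  The bound \<open>B\<close> does not
  depend on the starting vector; only the number of steps needed to reach it does.
\<close>

lemma greedy_bounded_sums:
  fixes P :: "nat \<Rightarrow> 'a \<Rightarrow> real"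
  assumes "0 < c"
    and descent: "\<And>v. \<exists>z\<in>S. (\<Sum>i<m. v i * P i z) \<le> - c * sqrt (\<Sum>i<m. (v i)\<^sup>2)"
    and bound: "\<And>z. z \<in> S \<Longrightarrow> (\<Sum>i<m. (P i z)\<^sup>2) \<le> C"
  obtains B where "\<And>v. \<exists>n0. \<forall>n\<ge>n0. \<exists>Z. set_mset Z \<subseteq> S \<and> size Z = n \<and>
                            (\<forall>i<m. \<bar>v i + (\<Sum>z\<in>#Z. P i z)\<bar> \<le> B)"
proof -
  define E where "E v = (\<Sum>i<m. (v i)\<^sup>2)" for v :: "nat \<Rightarrow> real"
  have E_nonneg: "0 \<le> E v" for v by (simp add: E_def sum_nonneg)
  have "0 \<le> C"
    using descent bound sum_nonneg[of "{..<m}"] by (meson order_trans zero_le_power2)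
  \<comment> \<open>For \<open>|v| \<ge> b\<close> the change \<open>- 2 c |v| + C\<close> of the energy is at most \<open>- 1\<close>.\<close>
  define b where "b = (C + 1) / (2 * c)"
  have "0 \<le> b" using \<open>0 \<le> C\<close> \<open>0 < c\<close> by (simp add: b_def)
  have step: "\<exists>z\<in>S. E (\<lambda>i. v i + P i z) \<le> max (b\<^sup>2 + C) (E v - 1)" for v
  proof -
    obtain z where z: "z \<in> S" "(\<Sum>i<m. v i * P i z) \<le> - c * sqrt (E v)"
      using descent[of v] unfolding E_def by blast
    have "E (\<lambda>i. v i + P i z) = E v + 2 * (\<Sum>i<m. v i * P i z) + (\<Sum>i<m. (P i z)\<^sup>2)"
      by (simp add: E_def power2_sum sum.distrib sum_distrib_left algebra_simps)
    also have "\<dots> \<le> E v - 2 * c * sqrt (E v) + C"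
      using z bound[OF z(1)] by simp
    also have "\<dots> \<le> max (b\<^sup>2 + C) (E v - 1)"
    proof (cases "sqrt (E v) \<le> b")
      case True
      then have "E v \<le> b\<^sup>2" by (rule sqrt_le_D)
      moreover have "0 \<le> 2 * c * sqrt (E v)" using \<open>0 < c\<close> E_nonneg by simp
      ultimately show ?thesis by linarith
    next
      case False
      then have "2 * c * b \<le> 2 * c * sqrt (E v)" using \<open>0 < c\<close> by simp
      then show ?thesis using \<open>0 < c\<close> by (simp add: b_def)
    qed
    finally show ?thesis using z(1) by blast
  qed
  have iterate: "\<exists>Z. set_mset Z \<subseteq> S \<and> size Z = n \<and>
      E (\<lambda>i. v i + (\<Sum>z\<in>#Z. P i z)) \<le> max (b\<^sup>2 + C) (E v - real n)" for v n
  proof (induction n)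
    case 0
    show ?case by (rule exI[of _ "{#}"]) simp
  next
    case (Suc n)
    then obtain Z where Z: "set_mset Z \<subseteq> S" "size Z = n"
      "E (\<lambda>i. v i + (\<Sum>z\<in>#Z. P i z)) \<le> max (b\<^sup>2 + C) (E v - real n)" by blast
    obtain z where z: "z \<in> S" "E (\<lambda>i. v i + (\<Sum>z\<in>#Z. P i z) + P i z)
        \<le> max (b\<^sup>2 + C) (E (\<lambda>i. v i + (\<Sum>z\<in>#Z. P i z)) - 1)"
      using step[of "\<lambda>i. v i + (\<Sum>z\<in>#Z. P i z)"] by blast
    have "E (\<lambda>i. v i + (\<Sum>z\<in>#add_mset z Z. P i z)) = E (\<lambda>i. v i + (\<Sum>z\<in>#Z. P i z) + P i z)"
      by (simp add: algebra_simps)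
    then have "E (\<lambda>i. v i + (\<Sum>z\<in>#add_mset z Z. P i z)) \<le> max (b\<^sup>2 + C) (E v - real (Suc n))"
      using z(2) Z(3) by simp
    with Z z(1) show ?case by (intro exI[of _ "add_mset z Z"]) simp
  qed
  show ?thesis
  proof
    fix v :: "nat \<Rightarrow> real"
    show "\<exists>n0. \<forall>n\<ge>n0. \<exists>Z. set_mset Z \<subseteq> S \<and> size Z = n \<and>
                            (\<forall>i<m. \<bar>v i + (\<Sum>z\<in>#Z. P i z)\<bar> \<le> sqrt (b\<^sup>2 + C))"
    proof (rule exI[of _ "nat \<lceil>E v\<rceil>"], intro allI impI)
      fix n assume n: "nat \<lceil>E v\<rceil> \<le> n"
      obtain Z where Z: "set_mset Z \<subseteq> S" "size Z = n"
        and EZ: "E (\<lambda>i. v i + (\<Sum>z\<in>#Z. P i z)) \<le> max (b\<^sup>2 + C) (E v - real n)"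
        using iterate[of n v] by blast
      have "E v - real n \<le> 0" using n by linarith
      then have EZ': "E (\<lambda>i. v i + (\<Sum>z\<in>#Z. P i z)) \<le> b\<^sup>2 + C"
        using EZ \<open>0 \<le> C\<close> zero_le_power2[of b] by linarith
      have "\<bar>v i + (\<Sum>z\<in>#Z. P i z)\<bar> \<le> sqrt (b\<^sup>2 + C)" if "i < m" for i
      proof (rule real_le_rsqrt)
        have "(v i + (\<Sum>z\<in>#Z. P i z))\<^sup>2 \<le> E (\<lambda>i. v i + (\<Sum>z\<in>#Z. P i z))"
          unfolding E_def using that by (intro member_le_sum) auto
        with EZ' show "\<bar>v i + (\<Sum>z\<in>#Z. P i z)\<bar>\<^sup>2 \<le> b\<^sup>2 + C" by simp
      qed
      with Z show "\<exists>Z. set_mset Z \<subseteq> S \<and> size Z = n \<and>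
                            (\<forall>i<m. \<bar>v i + (\<Sum>z\<in>#Z. P i z)\<bar> \<le> sqrt (b\<^sup>2 + C))" by blast
    qed
  qed
qed

section \<open>Great circles\<close>

definition great_circle :: "'a::real_vector \<Rightarrow> 'a \<Rightarrow> real \<Rightarrow> 'a" where
  "great_circle x v s = cos s *\<^sub>R x + sin s *\<^sub>R v"

definition unit_tangents :: "('a::real_inner \<times> 'a) set" where
  "unit_tangents = {(x, v). norm x = 1 \<and> norm v = 1 \<and> inner x v = 0}"

lemma great_circle_0 [simp]: "great_circle x v 0 = x"
  by (simp add: great_circle_def)

lemma inner_great_circle:
  assumes "(x, v) \<in> unit_tangents"
  shows "inner (great_circle x v s) (great_circle x v r) = cos (s - r)"
  using assms
  by (auto simp: unit_tangents_def great_circle_def norm_eq_1 inner_commute inner_add_left inner_add_right cos_diff)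

text \<open>
  A shift of the parameter by \<open>\<pi>/2\<close> differentiates a great circle, so this pairs the
  point at time \<open>s\<close> with the velocity there.  Any great circle can thus be re-based at any
  of its points, and derivatives at parameter \<open>0\<close> suffice to control the whole circle.
\<close>

lemma great_circle_moving_frame:
  assumes "(x, v) \<in> unit_tangents"
  shows "(great_circle x v s, great_circle x v (s + pi / 2)) \<in> unit_tangents"
  using assms by (simp add: unit_tangents_def norm_eq_1 inner_great_circle[OF assms])

lemma great_circle_in_sphere:
  "(x, v) \<in> unit_tangents \<Longrightarrow> great_circle x v s \<in> sphere 0 1"
  using great_circle_moving_frame[of x v s] by (simp add: unit_tangents_def)

lemma great_circle_add:
  "great_circle x v (s + h) = great_circle (great_circle x v s) (great_circle x v (s + pi / 2)) h"
  by (simp add: great_circle_def sin_add cos_add algebra_simps)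

lemma great_circle_through:
  fixes x y :: "'a::euclidean_space"
  assumes "2 \<le> DIM('a)" "norm x = 1" "norm y = 1"
  obtains v s where "(x, v) \<in> unit_tangents" "great_circle x v s = y"
proof (cases "y - inner x y *\<^sub>R x = 0")
  case True
  obtain u where u: "u \<noteq> 0" "orthogonal x u"
    using orthogonal_to_vector_exists assms(1) by blast
  have xv: "(x, sgn u) \<in> unit_tangents"
    using u assms by (simp add: unit_tangents_def norm_sgn orthogonal_def sgn_div_norm)
  have y: "y = inner x y *\<^sub>R x" using True by simp
  then have "norm y = \<bar>inner x y\<bar> * norm x" by (metis norm_scaleR)
  then have "\<bar>inner x y\<bar> = 1" using assms by simp
  then have "great_circle x (sgn u) (if inner x y = 1 then 0 else pi) = y"
    using y by (auto simp: great_circle_def abs_if split: if_splits)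
  with xv show ?thesis by (rule that)
next
  case False
  define w where "w = y - inner x y *\<^sub>R x"
  have w: "w \<noteq> 0" "inner x w = 0"
    using False assms(2) by (simp_all add: w_def inner_diff_right norm_eq_1)
  have xv: "(x, sgn w) \<in> unit_tangents"
    using w assms by (simp add: unit_tangents_def norm_sgn sgn_div_norm)
  have y: "y = inner x y *\<^sub>R x + norm w *\<^sub>R sgn w"
    using w by (simp add: sgn_div_norm) (simp add: w_def)
  have "(inner x y)\<^sup>2 + (norm w)\<^sup>2 = 1"
  proof -
    have "1 = inner y y" using assms by (simp add: norm_eq_1)
    also have "\<dots> = inner (inner x y *\<^sub>R x + w) (inner x y *\<^sub>R x + w)" by (simp add: w_def)
    also have "\<dots> = (inner x y)\<^sup>2 * inner x x + inner w w"
      using w by (simp add: inner_add_left inner_add_right inner_commute power2_eq_square)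
    finally show ?thesis using assms(2) by (simp add: power2_norm_eq_inner norm_eq_1)
  qed
  then obtain s where "inner x y = cos s" "norm w = sin s"
    using sincos_total_2pi by metis
  with y have "great_circle x (sgn w) s = y" by (simp add: great_circle_def)
  with xv show ?thesis by (rule that)
qed

section \<open>Functions that are continuously differentiable along great circles\<close>

text \<open>
  A notion of smoothness on the sphere that only speaks about functions of one real variable.
  Continuity is required on the whole space, which makes restrictions to the sphere integrable
  and measurable for free.
\<close>

definition sphere_C1 :: "('a::euclidean_space \<Rightarrow> real) set" where
  "sphere_C1 = {f. continuous_on UNIV f \<and>
     (\<forall>(x, v)\<in>unit_tangents. (\<lambda>s. f (great_circle x v s)) C1_differentiable_on UNIV)}"

lemma sphere_C1_const: "(\<lambda>_. c) \<in> sphere_C1"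
  by (auto simp: sphere_C1_def)

lemma sphere_C1_add: "\<lbrakk>f \<in> sphere_C1; g \<in> sphere_C1\<rbrakk> \<Longrightarrow> (\<lambda>x. f x + g x) \<in> sphere_C1"
  by (auto simp: sphere_C1_def intro!: continuous_intros derivative_intros)

lemma sphere_C1_mult: "\<lbrakk>f \<in> sphere_C1; g \<in> sphere_C1\<rbrakk> \<Longrightarrow> (\<lambda>x. f x * g x) \<in> sphere_C1"
  by (auto simp: sphere_C1_def intro!: continuous_intros derivative_intros)

lemma sphere_C1_power: "f \<in> sphere_C1 \<Longrightarrow> (\<lambda>x. f x ^ n) \<in> sphere_C1"
  by (induction n) (simp_all add: sphere_C1_const sphere_C1_mult)

lemma sphere_C1_prod:
  "(\<And>i. i \<in> I \<Longrightarrow> f i \<in> sphere_C1) \<Longrightarrow> (\<lambda>x. \<Prod>i\<in>I. f i x) \<in> sphere_C1"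
  by (induction I rule: infinite_finite_induct) (simp_all add: sphere_C1_const sphere_C1_mult)

lemma sphere_C1_inner: "(\<lambda>x. inner x b) \<in> sphere_C1"
proof -
  have "(\<lambda>s. inner (great_circle x v s) b) C1_differentiable_on UNIV" for x v :: 'a
    unfolding C1_differentiable_on_def great_circle_def
      has_real_derivative_iff_has_vector_derivative[symmetric]
    by (rule exI[of _ "\<lambda>s. - sin s * inner x b + cos s * inner v b"])
       (auto simp: inner_add_left intro!: derivative_eq_intros continuous_intros)
  then show ?thesis by (auto simp: sphere_C1_def intro!: continuous_intros)
qed

text \<open>
  Any two points of the sphere lie on a common great circle.  This fails for the two-point sphere
  of dimension zero, hence the assumption on the dimension.
\<close>

lemma constant_on_sphere_if_circle_derivs_zero:
  fixes f :: "'a::euclidean_space \<Rightarrow> real"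
  assumes "2 \<le> DIM('a)" and f: "f \<in> sphere_C1"
    and z: "\<And>x v. (x, v) \<in> unit_tangents \<Longrightarrow> deriv (\<lambda>s. f (great_circle x v s)) 0 = 0"
    and xy: "norm x = 1" "norm y = 1"
  shows "f x = f y"
proof -
  obtain v s where xv: "(x, v) \<in> unit_tangents" and y: "great_circle x v s = y"
    using great_circle_through assms(1) xy by blast
  have "((\<lambda>s. f (great_circle x v s)) has_real_derivative 0) (at s)" for s
  proof -
    let ?x = "great_circle x v s" and ?v = "great_circle x v (s + pi / 2)"
    have t: "(?x, ?v) \<in> unit_tangents" by (rule great_circle_moving_frame[OF xv])
    then have "(\<lambda>h. f (great_circle ?x ?v h)) C1_differentiable_on UNIV"
      using f by (auto simp: sphere_C1_def)
    then have "((\<lambda>h. f (great_circle ?x ?v h)) has_real_derivative 0) (at 0)"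
      using C1_imp_DERIV[of "\<lambda>h. f (great_circle ?x ?v h)" 0] by (simp only: z[OF t])
    moreover have "(\<lambda>h. f (great_circle ?x ?v h)) = (\<lambda>h. f (great_circle x v (h + s)))"
      unfolding great_circle_add[symmetric] by (simp only: add.commute)
    ultimately have "((\<lambda>h. f (great_circle x v (h + s))) has_real_derivative 0) (at 0)"
      by (simp only:)
    then show ?thesis
      by (simp only: add_0 DERIV_shift[of "\<lambda>s. f (great_circle x v s)" 0 0 s, unfolded add_0])
  qed
  then have "f (great_circle x v 0) = f (great_circle x v s)"
    using DERIV_isconst_all[of "\<lambda>s. f (great_circle x v s)" 0 s] by blast
  then show ?thesis by (simp add: y)
qed

section \<open>Integration over the sphere\<close>

lemma integrable_sphere_continuous:
  fixes f :: "'a::euclidean_space \<Rightarrow> real"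
  assumes c: "continuous_on UNIV f"
  shows "integrable sphere_measure f"
proof -
  interpret prob_space "sphere_measure :: 'a measure" by (rule prob_space_sphere_measure)
  have "compact (f ` sphere 0 1)"
    by (rule compact_continuous_image[OF continuous_on_subset[OF c] compact_sphere]) simp
  then obtain B where B: "\<And>x. x \<in> sphere 0 1 \<Longrightarrow> \<bar>f x\<bar> \<le> B"
    by (fastforce dest!: compact_imp_bounded simp: bounded_iff)
  have "f \<in> borel_measurable sphere_measure"
    using borel_measurable_continuous_onI[OF c]
    by (subst measurable_cong_sets[OF sets_sphere_measure refl]) (rule measurable_restrict_space1)
  then show ?thesis
    by (intro integrable_const_bound[of _ B] AE_I2) (simp_all add: B)
qed

text \<open>
  The cone over a relatively open part of the sphere contains an open subset of the unit ball
  near half of any of its unit vectors.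
\<close>

lemma emeasure_sphere_open_pos:
  fixes U :: "'a::euclidean_space set"
  assumes "open U" "x \<in> U" "norm x = 1"
  shows "0 < emeasure sphere_measure (U \<inter> sphere 0 1)"
proof -
  define C where "C = {y \<in> ball 0 1 - {0::'a}. sgn y \<in> U}"
  have "C = sgn -` U \<inter> (ball 0 1 - {0})" by (auto simp: C_def)
  also have "open \<dots>"
    by (subst Int_commute, rule continuous_open_preimage[OF _ _ \<open>open U\<close>]) (auto intro!: continuous_intros)
  finally have "open C" .
  moreover have "(1/2) *\<^sub>R x \<in> C"
    using assms by (auto simp: C_def sgn_div_norm)
  ultimately obtain e where e: "0 < e" "ball ((1/2) *\<^sub>R x) e \<subseteq> C"
    using open_contains_ball by blast
  have sub: "C \<subseteq> {y \<in> cball 0 1 - {0}. sgn y \<in> U \<inter> sphere 0 1}"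
    by (auto simp: C_def norm_sgn)
  have meas: "{y \<in> cball 0 1 - {0}. sgn y \<in> A} \<in> sets borel" if "A \<in> sets borel" for A :: "'a set"
    using that by measurable
  have "0 < emeasure lborel (ball ((1/2) *\<^sub>R x) e)"
    using e(1) by (simp add: emeasure_ball)
  also have "\<dots> \<le> emeasure lborel {y \<in> cball 0 1 - {0}. sgn y \<in> U \<inter> sphere 0 1}"
    by (intro emeasure_mono order_trans[OF e(2) sub])
      (simp only: sets_lborel meas[OF sets.Int[OF borel_open[OF \<open>open U\<close>] borel_closed[OF closed_sphere]]])
  finally show ?thesis
    using \<open>open U\<close>
    by (subst emeasure_sphere_measure) (auto simp: ennreal_zero_less_divide emeasure_cball)
qed

lemma zero_on_sphere_if_square_integral_zero:
  fixes f :: "'a::euclidean_space \<Rightarrow> real"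
  assumes c: "continuous_on UNIV f" and z: "(LINT x|sphere_measure. f x * f x) = 0"
  shows "\<forall>x\<in>sphere 0 1. f x = 0"
proof (rule ccontr)
  assume "\<not> (\<forall>x\<in>sphere 0 1. f x = 0)"
  then obtain x where x: "norm x = 1" "f x \<noteq> 0" by auto
  have op: "open (f -` (- {0}))"
    by (rule open_vimage) (auto intro: c)
  have pos: "0 < emeasure sphere_measure (f -` (- {0}) \<inter> sphere 0 1)"
    by (rule emeasure_sphere_open_pos[OF op]) (use x in auto)
  have "AE x in sphere_measure. f x * f x = 0"
    using z by (subst (asm) integral_nonneg_eq_0_iff_AE)
      (auto intro!: integrable_sphere_continuous continuous_intros c)
  then have "AE x in sphere_measure. \<not> (x \<in> f -` (- {0}) \<inter> sphere 0 1)" by auto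
  moreover have "f -` (- {0}) \<inter> sphere 0 1 \<in> sets sphere_measure"
    unfolding sets_sphere_measure sets_restrict_space using borel_open[OF op] by blast
  ultimately have "f -` (- {0}) \<inter> sphere 0 1 \<in> null_sets sphere_measure"
    by (simp only: AE_iff_null_sets)
  with pos show False by (simp add: null_sets_def)
qed

section \<open>Mean-zero functions\<close>

definition mean_zero :: "('a::euclidean_space \<Rightarrow> real) set" where
  "mean_zero = {f \<in> sphere_C1. (LINT x|sphere_measure. f x) = 0}"

lemma sphere_C1_continuous: "f \<in> sphere_C1 \<Longrightarrow> continuous_on UNIV f"
  by (simp add: sphere_C1_def)

lemma sphere_C1_DERIV:
  assumes "f \<in> sphere_C1" "(x, v) \<in> unit_tangents"
  shows "((\<lambda>s. f (great_circle x v s)) has_real_derivative deriv (\<lambda>s. f (great_circle x v s)) 0) (at 0)"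
proof -
  have "(\<lambda>s. f (great_circle x v s)) C1_differentiable_on UNIV"
    using assms by (auto simp: sphere_C1_def)
  then show ?thesis by (rule C1_imp_DERIV)
qed

lemma mean_zero_lincomb:
  assumes "f \<in> mean_zero" "g \<in> mean_zero"
  shows "(\<lambda>x. f x + c * g x) \<in> mean_zero"
proof -
  have C1: "f \<in> sphere_C1" "(\<lambda>x. c * g x) \<in> sphere_C1"
    using assms by (auto simp: mean_zero_def intro: sphere_C1_mult sphere_C1_const)
  have "(LINT x|sphere_measure. f x + c * g x) = (LINT x|sphere_measure. f x) + (LINT x|sphere_measure. c * g x)"
    by (intro Bochner_Integration.integral_add integrable_sphere_continuous sphere_C1_continuous C1)
  also have "\<dots> = 0" using assms by (simp add: mean_zero_def)
  finally show ?thesis using sphere_C1_add[OF C1] by (simp add: mean_zero_def)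
qed

text \<open>
  Derivatives along great circles separate mean-zero functions: if they all vanish, the function is
  constant on the sphere, and the constant is its mean.  So a basis can be chosen that is
  dual to derivatives at finitely many points.  Moving the \<open>j\<close>-th of these points changes to first
  order only the sum of the \<open>j\<close>-th basis function.
\<close>

lemma tangent_dual_system:
  fixes F :: "('a::euclidean_space \<Rightarrow> real) set"
  assumes dim: "2 \<le> DIM('a)" and F: "finite F" "F \<subseteq> mean_zero"
  obtains m :: nat and P x v where
    "\<And>i. i < m \<Longrightarrow> P i \<in> mean_zero" "\<And>j. j < m \<Longrightarrow> (x j, v j) \<in> unit_tangents"
    "\<And>i j. \<lbrakk>i < m; j < m\<rbrakk> \<Longrightarrow>
       ((\<lambda>s. P i (great_circle (x j) (v j) s)) has_real_derivative of_bool (i = j)) (at 0)"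
    "\<And>f. f \<in> F \<Longrightarrow> \<exists>c. \<forall>z\<in>sphere 0 1. f z = (\<Sum>i<m. c i * P i z)"
proof -
  define T where "T = (\<lambda>p (f :: 'a \<Rightarrow> real). deriv (\<lambda>s. f (great_circle (fst p) (snd p) s)) 0)"
  have C1: "f \<in> sphere_C1" if "f \<in> mean_zero" for f :: "'a \<Rightarrow> real"
    using that by (simp add: mean_zero_def)
  have T_DERIV: "((\<lambda>s. f (great_circle x v s)) has_real_derivative T (x, v) f) (at 0)"
    if "f \<in> mean_zero" "(x, v) \<in> unit_tangents" for f x v
    using sphere_C1_DERIV[OF C1[OF that(1)] that(2)] by (simp add: T_def)
  obtain m :: nat and P D where PD: "\<And>i. i < m \<Longrightarrow> P i \<in> mean_zero" "\<And>j. j < m \<Longrightarrow> D j \<in> T ` unit_tangents"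
    "\<And>i j. \<lbrakk>i < m; j < m\<rbrakk> \<Longrightarrow> D j (P i) = of_bool (i = j)"
    "\<And>f. f \<in> F \<Longrightarrow> \<exists>c. \<forall>z\<in>sphere 0 1. f z = (\<Sum>i<m. c i * P i z)"
  proof (rule dual_system[of mean_zero "T ` unit_tangents" "sphere 0 1" F])
    show "(\<lambda>x. f x + c * g x) \<in> mean_zero" if "f \<in> mean_zero" "g \<in> mean_zero" for f g :: "'a \<Rightarrow> real" and c
      using that by (rule mean_zero_lincomb)
    show "D (\<lambda>x. f x + c * g x) = D f + c * D g"
      if "D \<in> T ` unit_tangents" "f \<in> mean_zero" "g \<in> mean_zero" for D f g c
    proof -
      obtain x v where xv: "(x, v) \<in> unit_tangents" "D = T (x, v)"
        using \<open>D \<in> T ` unit_tangents\<close> by auto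
      have "((\<lambda>s. f (great_circle x v s) + c * g (great_circle x v s)) has_real_derivative D f + c * D g) (at 0)"
        unfolding xv(2) by (intro DERIV_add DERIV_cmult T_DERIV that xv)
      from DERIV_imp_deriv[OF this] show ?thesis by (simp add: xv(2) T_def)
    qed
    show "\<forall>x\<in>sphere 0 1. f x = 0"
      if f: "f \<in> mean_zero" and z: "\<And>D. D \<in> T ` unit_tangents \<Longrightarrow> D f = 0" for f
    proof
      fix x :: 'a assume x: "x \<in> sphere 0 1"
      have deriv_zero: "deriv (\<lambda>s. f (great_circle y v s)) 0 = 0" if "(y, v) \<in> unit_tangents" for y v
        using z[OF imageI[OF that]] by (simp add: T_def)
      have const: "f y = f x" if "y \<in> sphere 0 1" for y
        by (rule constant_on_sphere_if_circle_derivs_zero[OF dim C1[OF f] deriv_zero])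
          (use x that in auto)
      have "0 = (LINT y|sphere_measure. f y)" using f by (simp add: mean_zero_def)
      also have "\<dots> = (LINT y|(sphere_measure :: 'a measure). f x)"
        by (rule Bochner_Integration.integral_cong) (use const in auto)
      also have "\<dots> = f x"
        using prob_space.prob_space[OF prob_space_sphere_measure[where 'a = 'a]] by simp
      finally show "f x = 0" by simp
    qed
  qed (use F in auto)
  have "\<forall>j. \<exists>p. j < m \<longrightarrow> p \<in> unit_tangents \<and> D j = T p" using PD(2) by blast
  then obtain p where p: "\<And>j. j < m \<Longrightarrow> p j \<in> unit_tangents \<and> D j = T (p j)" by metis
  show ?thesis
  proof (rule that[of m P "fst \<circ> p" "snd \<circ> p"])
    show "((fst \<circ> p) j, (snd \<circ> p) j) \<in> unit_tangents" if "j < m" for j using p[OF that] by simp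
    then show "((\<lambda>s. P i (great_circle ((fst \<circ> p) j) ((snd \<circ> p) j) s)) has_real_derivative of_bool (i = j)) (at 0)"
      if "i < m" "j < m" for i j
      using T_DERIV[OF PD(1)[OF that(1)], of "fst (p j)" "snd (p j)"] PD(3)[OF that] p[OF that(2)] that by simp
  qed (use PD in auto)
qed

text \<open>
  The pairings with mean-zero functions separate mean-zero functions, because a function can be paired
  with itself.
\<close>

lemma integral_dual_system:
  fixes F :: "('a::euclidean_space \<Rightarrow> real) set"
  assumes F: "finite F" "F \<subseteq> mean_zero"
  obtains m :: nat and P g where
    "\<And>i. i < m \<Longrightarrow> P i \<in> mean_zero" "\<And>j. j < m \<Longrightarrow> g j \<in> mean_zero"
    "\<And>i j. \<lbrakk>i < m; j < m\<rbrakk> \<Longrightarrow> (LINT x|sphere_measure. P i x * g j x) = of_bool (i = j)"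
    "\<And>f. f \<in> F \<Longrightarrow> \<exists>c. \<forall>z\<in>sphere 0 1. f z = (\<Sum>i<m. c i * P i z)"
proof -
  define T where "T = (\<lambda>(g :: 'a \<Rightarrow> real) f. LINT x|sphere_measure. f x * g x)"
  have cont: "continuous_on UNIV f" if "f \<in> mean_zero" for f :: "'a \<Rightarrow> real"
    using that by (simp add: mean_zero_def sphere_C1_def)
  obtain m :: nat and P D where PD: "\<And>i. i < m \<Longrightarrow> P i \<in> mean_zero" "\<And>j. j < m \<Longrightarrow> D j \<in> T ` mean_zero"
    "\<And>i j. \<lbrakk>i < m; j < m\<rbrakk> \<Longrightarrow> D j (P i) = of_bool (i = j)"
    "\<And>f. f \<in> F \<Longrightarrow> \<exists>c. \<forall>z\<in>sphere 0 1. f z = (\<Sum>i<m. c i * P i z)"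
  proof (rule dual_system[of mean_zero "T ` mean_zero" "sphere 0 1" F])
    show "(\<lambda>x. f x + c * g x) \<in> mean_zero" if "f \<in> mean_zero" "g \<in> mean_zero" for f g :: "'a \<Rightarrow> real" and c
      using that by (rule mean_zero_lincomb)
    show "D (\<lambda>x. f x + c * g x) = D f + c * D g"
      if "D \<in> T ` mean_zero" "f \<in> mean_zero" "g \<in> mean_zero" for D f g c
    proof -
      obtain h where h: "h \<in> mean_zero" "D = T h" using \<open>D \<in> T ` mean_zero\<close> by auto
      have "D (\<lambda>x. f x + c * g x) = (LINT x|sphere_measure. f x * h x + c * (g x * h x))"
        by (simp add: h(2) T_def algebra_simps)
      also have "\<dots> = (LINT x|sphere_measure. f x * h x) + (LINT x|sphere_measure. c * (g x * h x))"
        by (intro Bochner_Integration.integral_add integrable_sphere_continuous continuous_intros cont that h)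
      also have "\<dots> = D f + c * D g" by (simp add: h(2) T_def)
      finally show ?thesis .
    qed
    show "\<forall>x\<in>sphere 0 1. f x = 0"
      if f: "f \<in> mean_zero" and z: "\<And>D. D \<in> T ` mean_zero \<Longrightarrow> D f = 0" for f
    proof (rule zero_on_sphere_if_square_integral_zero[OF cont[OF f]])
      have "T f f = 0" using f by (intro z imageI)
      then show "(LINT x|sphere_measure. f x * f x) = 0" by (simp only: T_def)
    qed
  qed (use F in auto)
  have "\<forall>j. \<exists>g. j < m \<longrightarrow> g \<in> mean_zero \<and> D j = T g" using PD(2) by blast
  then obtain g where g: "\<And>j. j < m \<Longrightarrow> g j \<in> mean_zero \<and> D j = T (g j)" by metis
  show ?thesis
  proof (rule that[of m P g])
    show "(LINT x|sphere_measure. P i x * g j x) = of_bool (i = j)" if "i < m" "j < m" for i j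
      using PD(3)[OF that] g[OF that(2)] by (simp add: T_def)
  qed (use PD g in auto)
qed

lemma bounded_on_sphere:
  fixes f :: "nat \<Rightarrow> 'a::euclidean_space \<Rightarrow> real"
  assumes "\<And>i. i < m \<Longrightarrow> continuous_on UNIV (f i)"
  obtains G where "0 < G" "\<And>i x. \<lbrakk>i < m; x \<in> sphere 0 1\<rbrakk> \<Longrightarrow> \<bar>f i x\<bar> \<le> G"
proof -
  have "compact ((\<lambda>x. \<Sum>i<m. \<bar>f i x\<bar>) ` sphere 0 1)"
    by (intro compact_continuous_image compact_sphere continuous_intros)
      (auto intro: continuous_on_subset[OF assms])
  then obtain B where B: "0 < B" "\<And>x. x \<in> sphere 0 1 \<Longrightarrow> \<bar>\<Sum>i<m. \<bar>f i x\<bar>\<bar> \<le> B"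
    by (auto dest!: compact_imp_bounded simp: bounded_pos)
  have "\<bar>f i x\<bar> \<le> B" if "i < m" "x \<in> sphere 0 1" for i x
  proof -
    have "\<bar>f i x\<bar> \<le> (\<Sum>i<m. \<bar>f i x\<bar>)" using that(1) by (intro member_le_sum) auto
    also have "\<dots> \<le> B" using B(2)[OF that(2)] by simp
    finally show ?thesis .
  qed
  with B(1) show ?thesis by (rule that)
qed

text \<open>
  The quantitative form of the fact that a nonzero mean-zero function takes negative values.
  If \<open>l = \<Sum>\<^sub>i v\<^sub>i P\<^sub>i\<close> stays above \<open>- a\<close> on the sphere, then \<open>|l| \<le> l + 2 a\<close> there, so \<open>|l|\<close> has
  integral at most \<open>2 a\<close>.  The coefficient \<open>v\<^sub>j\<close> is the integral of \<open>l g\<^sub>j\<close>, so it is at most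
  \<open>2 a G\<close> in absolute value, where \<open>G\<close> bounds all \<open>g\<^sub>j\<close>; hence \<open>a\<close> is at least a fixed multiple
  of \<open>|v|\<close>.
\<close>

lemma descent_direction:
  fixes P g :: "nat \<Rightarrow> 'a::euclidean_space \<Rightarrow> real"
  assumes P: "\<And>i. i < m \<Longrightarrow> P i \<in> mean_zero" and g: "\<And>j. j < m \<Longrightarrow> g j \<in> mean_zero"
    and dual: "\<And>i j. \<lbrakk>i < m; j < m\<rbrakk> \<Longrightarrow> (LINT x|sphere_measure. P i x * g j x) = of_bool (i = j)"
  obtains c where "0 < c"
    "\<And>v. \<exists>z\<in>sphere 0 1. (\<Sum>i<m. v i * P i z) \<le> - c * sqrt (\<Sum>i<m. (v i)\<^sup>2)"
proof -
  have Pc: "continuous_on UNIV (P i)" and gc: "continuous_on UNIV (g i)" if "i < m" for i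
    using P[OF that] g[OF that] by (simp_all add: mean_zero_def sphere_C1_def)
  obtain G where "0 < G" and G: "\<And>j x. \<lbrakk>j < m; x \<in> sphere 0 1\<rbrakk> \<Longrightarrow> \<bar>g j x\<bar> \<le> G"
    using bounded_on_sphere[of m g] gc by blast
  \<comment> \<open>With this \<open>c\<close>, the estimate \<open>|v| \<le> \<Sum>\<^sub>j |v\<^sub>j| \<le> 2 c G m |v|\<close> forces \<open>v = 0\<close>.\<close>
  define c where "c = 1 / (2 * G * (real m + 1))"
  have "0 < c" using \<open>0 < G\<close> by (simp add: c_def)
  have "\<exists>z\<in>sphere 0 1. (\<Sum>i<m. v i * P i z) \<le> - c * sqrt (\<Sum>i<m. (v i)\<^sup>2)" for v
  proof (rule ccontr)
    define L where "L = sqrt (\<Sum>i<m. (v i)\<^sup>2)"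
    define l where "l z = (\<Sum>i<m. v i * P i z)" for z
    assume "\<not> (\<exists>z\<in>sphere 0 1. (\<Sum>i<m. v i * P i z) \<le> - c * sqrt (\<Sum>i<m. (v i)\<^sup>2))"
    then have l_gt: "- c * L < l z" if "z \<in> sphere 0 1" for z
      using that by (force simp: L_def l_def not_le)
    have "0 \<le> L" by (simp add: L_def sum_nonneg)
    have lc: "continuous_on UNIV l"
      unfolding l_def[abs_def] by (intro continuous_intros Pc) auto
    have int: "integrable sphere_measure f" if "continuous_on UNIV f" for f :: "'a \<Rightarrow> real"
      using that by (rule integrable_sphere_continuous)
    have int_l: "(LINT x|sphere_measure. l x) = 0"
      unfolding l_def using P
      by (subst Bochner_Integration.integral_sum)
        (auto intro!: int continuous_intros Pc simp: mean_zero_def)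
    have "(LINT x|sphere_measure. \<bar>l x\<bar>) \<le> (LINT x|sphere_measure. l x + 2 * c * L)"
    proof (rule integral_mono)
      fix x :: 'a assume "x \<in> space sphere_measure"
      then have "- (c * L) < l x" using l_gt[of x] by simp
      moreover have "0 \<le> c * L" using \<open>0 < c\<close> \<open>0 \<le> L\<close> by simp
      ultimately show "\<bar>l x\<bar> \<le> l x + 2 * c * L" unfolding mult.assoc by linarith
    qed (intro int continuous_intros lc)+
    also have "\<dots> = 2 * c * L"
      using int[OF lc] int_l prob_space.prob_space[OF prob_space_sphere_measure]
      by (subst Bochner_Integration.integral_add) (auto intro!: int continuous_intros)
    finally have L1: "(LINT x|sphere_measure. \<bar>l x\<bar>) \<le> 2 * c * L" .
    have v_le: "\<bar>v j\<bar> \<le> 2 * c * G * L" if "j < m" for j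
    proof -
      have "(LINT x|sphere_measure. l x * g j x) = (LINT x|sphere_measure. (\<Sum>i<m. v i * (P i x * g j x)))"
        by (simp add: l_def sum_distrib_right mult.assoc)
      also have "\<dots> = (\<Sum>i<m. v i * (LINT x|sphere_measure. P i x * g j x))"
        using that by (subst Bochner_Integration.integral_sum) (auto intro!: int continuous_intros Pc gc)
      also have "\<dots> = v j" using that by (simp add: dual)
      finally have "\<bar>v j\<bar> = \<bar>(LINT x|sphere_measure. l x * g j x)\<bar>" by simp
      also have "\<dots> \<le> (LINT x|sphere_measure. \<bar>l x * g j x\<bar>)" by (rule integral_abs_bound)
      also have "\<dots> \<le> (LINT x|sphere_measure. G * \<bar>l x\<bar>)"
      proof (rule integral_mono)
        fix x :: 'a assume "x \<in> space sphere_measure"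
        then have "\<bar>l x\<bar> * \<bar>g j x\<bar> \<le> \<bar>l x\<bar> * G" using G[OF that] by (intro mult_left_mono) auto
        then show "\<bar>l x * g j x\<bar> \<le> G * \<bar>l x\<bar>" by (simp add: abs_mult mult.commute)
      qed (intro int continuous_intros lc gc that)+
      also have "\<dots> \<le> G * (2 * c * L)" using L1 \<open>0 < G\<close> by simp
      finally show ?thesis by (simp add: mult_ac)
    qed
    have "L \<le> (\<Sum>j<m. \<bar>v j\<bar>)"
      using L2_set_le_sum_abs[of v "{..<m}"] by (simp add: L_def L2_set_def)
    also have "\<dots> \<le> (\<Sum>j<m. 2 * c * G * L)" using v_le by (intro sum_mono) auto
    also have "\<dots> = real m / (real m + 1) * L" using \<open>0 < G\<close> by (simp add: c_def)
    finally have "L = 0" using \<open>0 \<le> L\<close> by (simp add: field_simps)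
    then have "\<forall>i<m. v i = 0" using v_le by fastforce
    then have "l z = 0" for z by (simp add: l_def)
    moreover obtain z :: 'a where "z \<in> sphere 0 1"
      using vector_choose_size[of 1] by (metis mem_sphere_0 zero_le_one)
    ultimately show False using l_gt[of z] \<open>L = 0\<close> by simp
  qed
  with \<open>0 < c\<close> show ?thesis by (rule that)
qed

section \<open>Completion of point sets\<close>

lemma sum_mset_lincomb:
  fixes f :: "'a \<Rightarrow> real"
  assumes "\<And>z. z \<in># M \<Longrightarrow> f z = (\<Sum>i\<in>I. c i * P i z)"
  shows "(\<Sum>z\<in>#M. f z) = (\<Sum>i\<in>I. c i * (\<Sum>z\<in>#M. P i z))"
  using assms by (induction M) (auto simp: sum.distrib algebra_simps)

lemma sum_mset_repeat_mset:
  fixes f :: "'a \<Rightarrow> real"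
  shows "(\<Sum>z\<in>#repeat_mset k M. f z) = real k * (\<Sum>z\<in>#M. f z)"
  by (induction k) (simp_all add: algebra_simps)

text \<open>
  The points \<open>X\<close> consist of two parts: \<open>k\<close> copies of a block of \<open>m\<close> points, which can be adjusted
  within a cube of half-width \<open>k r\<close>, and a set \<open>Z\<close> of greedily chosen points of the remaining size,
  which brings the total of everything, with the blocks in base position, to within a distance
  \<open>A\<close> of zero.  Since \<open>A\<close> depends neither on \<open>k\<close> nor on \<open>Y\<close>, there is a \<open>k\<close> with \<open>A \<le> k r\<close>,
  and the blocks can absorb the error.  The size of \<open>Z\<close> is arbitrary beyond some threshold, so
  every large \<open>N\<close> is reached.
\<close>

theorem exists_completion_with_zero_sums:
  fixes F :: "('a::euclidean_space \<Rightarrow> real) set" and Y :: "'a multiset"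
  assumes dim: "2 \<le> DIM('a)" and F: "finite F" "F \<subseteq> mean_zero" and Y: "set_mset Y \<subseteq> sphere 0 1"
  shows "\<exists>N0. \<forall>N\<ge>N0. \<exists>X. set_mset X \<subseteq> sphere 0 1 \<and> size X = N \<and> (\<forall>f\<in>F. (\<Sum>z\<in>#X + Y. f z) = 0)"
proof -
  obtain m :: nat and P x v where P: "\<And>i. i < m \<Longrightarrow> P i \<in> mean_zero"
    and xv: "\<And>j. j < m \<Longrightarrow> (x j, v j) \<in> unit_tangents"
    and der: "\<And>i j. \<lbrakk>i < m; j < m\<rbrakk> \<Longrightarrow>
       ((\<lambda>s. P i (great_circle (x j) (v j) s)) has_real_derivative of_bool (i = j)) (at 0)"
    and spanF: "\<And>f. f \<in> F \<Longrightarrow> \<exists>c. \<forall>z\<in>sphere 0 1. f z = (\<Sum>i<m. c i * P i z)"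
    using tangent_dual_system[OF dim F] by blast
  \<comment> \<open>The basis \<open>P\<close> serves the local adjustment; \<open>Q\<close> is a second basis, suited to the greedy choice.\<close>
  have "finite (P ` {..<m})" "P ` {..<m} \<subseteq> mean_zero" using P by auto
  then obtain n :: nat and Q g where Q: "\<And>l. l < n \<Longrightarrow> Q l \<in> mean_zero" "\<And>l. l < n \<Longrightarrow> g l \<in> mean_zero"
    "\<And>l k. \<lbrakk>l < n; k < n\<rbrakk> \<Longrightarrow> (LINT x|sphere_measure. Q l x * g k x) = of_bool (l = k)"
    and spanP: "\<And>f. f \<in> P ` {..<m} \<Longrightarrow> \<exists>c. \<forall>z\<in>sphere 0 1. f z = (\<Sum>l<n. c l * Q l z)"
    using integral_dual_system[of "P ` {..<m}"] by blast
  have "\<forall>i. \<exists>c. i < m \<longrightarrow> (\<forall>z\<in>sphere 0 1. P i z = (\<Sum>l<n. c l * Q l z))" using spanP by blast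
  then obtain a where a: "\<And>i z. \<lbrakk>i < m; z \<in> sphere 0 1\<rbrakk> \<Longrightarrow> P i z = (\<Sum>l<n. a i l * Q l z)" by metis
  obtain c where c: "0 < c"
    "\<And>v. \<exists>z\<in>sphere 0 1. (\<Sum>l<n. v l * Q l z) \<le> - c * sqrt (\<Sum>l<n. (v l)\<^sup>2)"
    using descent_direction[of n Q g, OF Q] by blast
  obtain G where "0 < G" and G: "\<And>l z. \<lbrakk>l < n; z \<in> sphere 0 1\<rbrakk> \<Longrightarrow> \<bar>Q l z\<bar> \<le> G"
    using bounded_on_sphere[of n Q] Q(1) by (auto simp: mean_zero_def sphere_C1_def)
  have Q2: "(\<Sum>l<n. (Q l z)\<^sup>2) \<le> (\<Sum>l<n. G\<^sup>2)" if "z \<in> sphere 0 1" for z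
    using G[OF _ that] \<open>0 < G\<close> by (intro sum_mono) (simp add: abs_le_square_iff[symmetric])
  obtain B where B: "\<And>v. \<exists>n0. \<forall>k\<ge>n0. \<exists>Z. set_mset Z \<subseteq> sphere 0 1 \<and> size Z = k \<and>
                            (\<forall>l<n. \<bar>v l + (\<Sum>z\<in>#Z. Q l z)\<bar> \<le> B)"
    using greedy_bounded_sums[OF c Q2] by blast
  obtain r where "0 < r" and r: "\<And>u. (\<And>i. i < m \<Longrightarrow> \<bar>u i\<bar> \<le> r) \<Longrightarrow>
       \<exists>s. \<forall>i<m. (\<Sum>j<m. P i (great_circle (x j) (v j) (s j))) = (\<Sum>j<m. P i (x j)) + u i"
  proof (rule near_identity_covers_cube[of m "\<lambda>i j s. P i (great_circle (x j) (v j) s)"])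
    show "(\<lambda>s. P i (great_circle (x j) (v j) s)) C1_differentiable_on UNIV" if "i < m" "j < m" for i j
      using P[OF that(1)] xv[OF that(2)] by (auto simp: mean_zero_def sphere_C1_def)
    show "((\<lambda>s. P i (great_circle (x j) (v j) s)) has_real_derivative of_bool (i = j)) (at 0)"
      if "i < m" "j < m" for i j
      using that by (rule der)
  qed auto
  define A where "A = (\<Sum>i<m. \<Sum>l<n. \<bar>a i l\<bar> * \<bar>B\<bar>)"
  define k where "k = Suc (nat \<lceil>A / r\<rceil>)"
  have "0 < k" by (simp add: k_def)
  have "A / r \<le> real k" unfolding k_def by linarith
  then have A_le: "A \<le> r * real k" using \<open>0 < r\<close> by (simp add: field_simps)
  obtain n0 where n0: "\<forall>q\<ge>n0. \<exists>Z. set_mset Z \<subseteq> sphere 0 1 \<and> size Z = q \<and>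
      (\<forall>l<n. \<bar>((\<Sum>z\<in>#Y. Q l z) + real k * (\<Sum>j<m. Q l (x j))) + (\<Sum>z\<in>#Z. Q l z)\<bar> \<le> B)"
    using B[of "\<lambda>l. (\<Sum>z\<in>#Y. Q l z) + real k * (\<Sum>j<m. Q l (x j))"] by blast
  show ?thesis
  proof (rule exI[of _ "n0 + k * m"], intro allI impI)
    fix N assume N: "n0 + k * m \<le> N"
    then have "n0 \<le> N - k * m" by simp
    then obtain Z where Z: "set_mset Z \<subseteq> sphere 0 1" "size Z = N - k * m"
      and ZB: "\<And>l. l < n \<Longrightarrow>
        \<bar>((\<Sum>z\<in>#Y. Q l z) + real k * (\<Sum>j<m. Q l (x j))) + (\<Sum>z\<in>#Z. Q l z)\<bar> \<le> B"
      using n0 by blast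
    \<comment> \<open>The error with all blocks in base position; each of the \<open>k\<close> blocks has to cancel \<open>u i / k\<close>.\<close>
    define u where "u i = (\<Sum>z\<in>#Y. P i z) + real k * (\<Sum>j<m. P i (x j)) + (\<Sum>z\<in>#Z. P i z)" for i
    have x_sphere: "x j \<in> sphere 0 1" if "j < m" for j
      using xv[OF that] by (simp add: unit_tangents_def)
    have u_le: "\<bar>u i\<bar> \<le> A" if "i < m" for i
    proof -
      have PY: "(\<Sum>z\<in>#Y. P i z) = (\<Sum>l<n. a i l * (\<Sum>z\<in>#Y. Q l z))"
        by (rule sum_mset_lincomb) (use a[OF that] Y in auto)
      have PZ: "(\<Sum>z\<in>#Z. P i z) = (\<Sum>l<n. a i l * (\<Sum>z\<in>#Z. Q l z))"
        by (rule sum_mset_lincomb) (use a[OF that] Z in auto)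
      have Px: "(\<Sum>j<m. P i (x j)) = (\<Sum>l<n. a i l * (\<Sum>j<m. Q l (x j)))"
        using a[OF that x_sphere] by (simp add: sum_distrib_left) (rule sum.swap)
      have "u i = (\<Sum>l<n. a i l * (((\<Sum>z\<in>#Y. Q l z) + real k * (\<Sum>j<m. Q l (x j))) + (\<Sum>z\<in>#Z. Q l z)))"
        unfolding u_def PY PZ Px by (simp add: sum_distrib_left sum.distrib[symmetric] algebra_simps)
      also have "\<bar>\<dots>\<bar> \<le> (\<Sum>l<n. \<bar>a i l\<bar> * \<bar>B\<bar>)"
      proof (rule order_trans[OF sum_abs sum_mono])
        fix l assume "l \<in> {..<n}"
        then show "\<bar>a i l * (((\<Sum>z\<in>#Y. Q l z) + real k * (\<Sum>j<m. Q l (x j))) + (\<Sum>z\<in>#Z. Q l z))\<bar> \<le> \<bar>a i l\<bar> * \<bar>B\<bar>"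
          unfolding abs_mult using ZB[of l] by (intro mult_left_mono) auto
      qed
      also have "\<dots> \<le> A" unfolding A_def
        using that by (intro member_le_sum[of i "{..<m}" "\<lambda>i. \<Sum>l<n. \<bar>a i l\<bar> * \<bar>B\<bar>"]) (auto intro: sum_nonneg)
      finally show ?thesis .
    qed
    have "\<bar>- u i / real k\<bar> \<le> r" if "i < m" for i
      using u_le[OF that] A_le \<open>0 < k\<close> by (simp add: field_simps)
    then obtain s where s: "\<And>i. i < m \<Longrightarrow>
        (\<Sum>j<m. P i (great_circle (x j) (v j) (s j))) = (\<Sum>j<m. P i (x j)) + (- u i / real k)"
      using r[of "\<lambda>i. - u i / real k"] by blast
    define W where "W = image_mset (\<lambda>j. great_circle (x j) (v j) (s j)) (mset_set {..<m})"
    define X where "X = Z + repeat_mset k W"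
    have W: "set_mset W \<subseteq> sphere 0 1" "size W = m"
      using great_circle_in_sphere[OF xv] by (auto simp: W_def)
    have "set_mset (repeat_mset k W) \<subseteq> set_mset W" by (induction k) auto
    then have X: "set_mset X \<subseteq> sphere 0 1" using Z W unfolding X_def by auto
    have size_X: "size X = N" using N Z W by (simp add: X_def)
    have zero: "(\<Sum>z\<in>#X + Y. P i z) = 0" if "i < m" for i
    proof -
      have "(\<Sum>z\<in>#W. P i z) = (\<Sum>j<m. P i (great_circle (x j) (v j) (s j)))"
        by (simp add: W_def image_mset.compositionality comp_def sum_unfold_sum_mset)
      then have "(\<Sum>z\<in>#X + Y. P i z)
          = (\<Sum>z\<in>#Z. P i z) + real k * ((\<Sum>j<m. P i (x j)) + (- u i / real k)) + (\<Sum>z\<in>#Y. P i z)"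
        by (simp add: X_def sum_mset_repeat_mset s[OF that])
      also have "\<dots> = (\<Sum>z\<in>#Z. P i z) + (real k * (\<Sum>j<m. P i (x j)) - u i) + (\<Sum>z\<in>#Y. P i z)"
        using \<open>0 < k\<close> by (simp add: field_simps)
      also have "\<dots> = 0" by (simp add: u_def)
      finally show ?thesis .
    qed
    have "(\<Sum>z\<in>#X + Y. f z) = 0" if "f \<in> F" for f
    proof -
      obtain c where "\<forall>z\<in>sphere 0 1. f z = (\<Sum>i<m. c i * P i z)" using spanF[OF \<open>f \<in> F\<close>] by blast
      then have "(\<Sum>z\<in>#X + Y. f z) = (\<Sum>i<m. c i * (\<Sum>z\<in>#X + Y. P i z))"
        using X Y by (intro sum_mset_lincomb) auto
      then show ?thesis using zero by simp
    qed
    with X size_X show "\<exists>X. set_mset X \<subseteq> sphere 0 1 \<and> size X = N \<and> (\<forall>f\<in>F. (\<Sum>z\<in>#X + Y. f z) = 0)"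
      by blast
  qed
qed

theorem theorem2:
  fixes d t M :: nat and Y :: "(real^'n) multiset"
  assumes "CARD('n) = d + 1" and "d \<ge> 1"
    and "set_mset Y \<subseteq> sphere 0 1" and "size Y = M"
  shows "\<exists>N0. \<forall>N\<ge>N0. \<exists>X :: (real^'n) multiset.
           set_mset X \<subseteq> sphere 0 1 \<and> size X = N \<and> spherical_design t (X + Y)"
proof -
  define mon where "mon \<alpha> x = (\<Prod>i\<in>UNIV. (x $ i) ^ \<alpha> i)" for \<alpha> and x :: "real^'n"
  define avg where "avg \<alpha> = (LINT x|sphere_measure. mon \<alpha> x)" for \<alpha>
  define I where "I = {\<alpha> :: 'n \<Rightarrow> nat. (\<Sum>i\<in>UNIV. \<alpha> i) \<le> t}"
  define F where "F = (\<lambda>\<alpha> x. mon \<alpha> x + (- avg \<alpha>)) ` I"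
  have "finite I" unfolding I_def by (rule finite_multi_indices)
  have mon_C1: "mon \<alpha> \<in> sphere_C1" for \<alpha>
    using sphere_C1_inner[of "axis _ 1 :: real^'n"] unfolding mon_def[abs_def]
    by (intro sphere_C1_prod sphere_C1_power) (simp add: inner_axis)
  have mon_int: "integrable sphere_measure (mon \<alpha>)" for \<alpha>
    by (intro integrable_sphere_continuous sphere_C1_continuous mon_C1)
  have "(\<lambda>x. mon \<alpha> x + (- avg \<alpha>)) \<in> mean_zero" for \<alpha>
  proof -
    interpret prob_space "sphere_measure :: (real^'n) measure" by (rule prob_space_sphere_measure)
    have "(LINT x|sphere_measure. mon \<alpha> x + (- avg \<alpha>)) = 0"
      using mon_int[of \<alpha>] prob_space by (simp add: avg_def)
    then show ?thesis
      using sphere_C1_add[OF mon_C1 sphere_C1_const] unfolding mean_zero_def by blast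
  qed
  then have F: "finite F" "F \<subseteq> mean_zero" using \<open>finite I\<close> by (auto simp: F_def)
  have "2 \<le> DIM(real^'n)" using assms by simp
  from exists_completion_with_zero_sums[OF this F assms(3)]
  obtain N0 where N0: "\<And>N. N0 \<le> N \<Longrightarrow> \<exists>X. set_mset X \<subseteq> sphere 0 1 \<and> size X = N \<and>
      (\<forall>f\<in>F. (\<Sum>z\<in>#X + Y. f z) = 0)" by blast
  show ?thesis
  \<comment> \<open>The successor makes the union nonempty, so that the average over it is meaningful.\<close>
  proof (rule exI[of _ "Suc N0"], intro allI impI)
    fix N assume "Suc N0 \<le> N"
    then obtain X where X: "set_mset X \<subseteq> sphere 0 1" "size X = N"
      and zero: "\<And>f. f \<in> F \<Longrightarrow> (\<Sum>z\<in>#X + Y. f z) = 0"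
      using N0[of N] by auto
    have "X \<noteq> {#}" using X \<open>Suc N0 \<le> N\<close> by auto
    have mon_sum: "(\<Sum>z\<in>#X + Y. mon \<alpha> z) = real (size (X + Y)) * avg \<alpha>" if "\<alpha> \<in> I" for \<alpha>
    proof -
      have "(\<Sum>z\<in>#X + Y. mon \<alpha> z + (- avg \<alpha>)) = 0"
        using that by (intro zero) (auto simp: F_def)
      then show ?thesis by (simp only: sum_mset.distrib sum_mset_constant)
    qed
    have "(LINT x|sphere_measure. p x) = (1 / real (size (X + Y))) * (\<Sum>z\<in>#X + Y. p z)"
      if "polynomial_degree_le t p" for p
    proof -
      obtain c where p: "p = (\<lambda>x. \<Sum>\<alpha>\<in>I. c \<alpha> * mon \<alpha> x)"
        using \<open>polynomial_degree_le t p\<close> unfolding polynomial_degree_le_def I_def mon_def by (elim exE)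
      have "(LINT x|sphere_measure. p x) = (\<Sum>\<alpha>\<in>I. c \<alpha> * avg \<alpha>)"
        unfolding p by (subst Bochner_Integration.integral_sum) (use mon_int in \<open>auto simp: avg_def\<close>)
      moreover have "(\<Sum>z\<in>#X + Y. p z) = (\<Sum>\<alpha>\<in>I. c \<alpha> * (\<Sum>z\<in>#X + Y. mon \<alpha> z))"
        by (rule sum_mset_lincomb) (simp add: p)
      then have "(\<Sum>z\<in>#X + Y. p z) = real (size (X + Y)) * (\<Sum>\<alpha>\<in>I. c \<alpha> * avg \<alpha>)"
        by (simp only: mon_sum sum_distrib_left mult.left_commute cong: sum.cong)
      ultimately show ?thesis using \<open>X \<noteq> {#}\<close> by (simp del: size_union image_mset_union)
    qed
    then have "spherical_design t (X + Y)"
      unfolding spherical_design_def using X assms(3) by auto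
    with X show "\<exists>X. set_mset X \<subseteq> sphere 0 1 \<and> size X = N \<and> spherical_design t (X + Y)" by blast
  qed
qed

end
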